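(* Let $p,m$ be positive integers. If $(a,b)$ is a starting position of $(p,m)$-Imitation Nim, then it is $P$ if and only if it is a $P$-position of $(p,m)$-Wythoff Nim.
   Context: Positions are pairs $(a,b)$ of non-negative integers, the heights of two piles of tokens. Two players alternate; a player unable to move loses (normal play). All games are symmetric in the two piles. A position is $P$ if the previous player (the one not about to move) wins given best play, and $N$ otherwise. **2-pile Nim.** A move removes a positive number of tokens from exactly one pile. **$m$-imitation.** Let $A$ and $B$ be the two piles, with $\#A\le \#B$, where the tokens are counted before the previous player's removal (if the piles have equal height, either one may play the role of $A$). If the previous player removed $x>0$ tokens from pile $A$, then the next player $m$-imitates the previous player's move if he removes $y\in\{x,x+1,\dots,x+m-1\}$ tokens from pile $B$. No other move is an $m$-imitation; in particular the first move of a game is not. **$(p,m)$-Imitation Nim.** Move as in 2-pile Nim, except that no player may make $p$ consecutive $m$-imitations (i.e. $m$-imitations on $p$ consecutive moves of his own). **$(p,m)$-Wythoff Nim.** From a position, a move removes either a positive number of tokens from exactly one pile, or $x>0$ tokens from one pile and $y>0$ tokens from the other with $|x-y|<m$. Before the next player moves from $(a,b)$, the previous player may announce at most $p-1$ positions $(a_i,b_i)$ with $b_i-a_i=b-a$, to which the next player may not move; once the next player has moved, this blocking is forgotten. A player with no available move loses. $P$-positions are the positions from which the previous player wins with best play (including best blocking). *)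

theory Defs
  imports Main
begin

text \<open>Outcomes under normal play of a game given by its move relation. The two outcomes are the
  least solution of the usual recursion, so an infinite line of play is won by nobody; in both games
  below the number of tokens decreases with every move.\<close>

inductive previous_wins :: "('s \<Rightarrow> 's \<Rightarrow> bool) \<Rightarrow> 's \<Rightarrow> bool"
  and next_wins :: "('s \<Rightarrow> 's \<Rightarrow> bool) \<Rightarrow> 's \<Rightarrow> bool"
  for move :: "'s \<Rightarrow> 's \<Rightarrow> bool"
where
  previous_winsI: "(\<And>t. move s t \<Longrightarrow> next_wins move t) \<Longrightarrow> previous_wins move s"
| next_winsI: "move s t \<Longrightarrow> previous_wins move t \<Longrightarrow> next_wins move s"

type_synonym position = "nat \<times> nat"

inductive nim_move :: "position \<Rightarrow> position \<Rightarrow> bool" where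
  "0 < x \<Longrightarrow> x \<le> a \<Longrightarrow> nim_move (a, b) (a - x, b)"
| "0 < y \<Longrightarrow> y \<le> b \<Longrightarrow> nim_move (a, b) (a, b - y)"


text \<open>\<open>imitation m u v w\<close>: after the previous player moved from \<open>u\<close> to \<open>v\<close>, the move from \<open>v\<close>
  to \<open>w\<close> is an \<open>m\<close>-imitation. The heights are compared in \<open>u\<close>, and both rules apply in case of
  equality. A pile keeps its coordinate throughout the play.\<close>

inductive imitation :: "nat \<Rightarrow> position \<Rightarrow> position \<Rightarrow> position \<Rightarrow> bool" for m :: nat where
  "a \<le> b \<Longrightarrow> 0 < x \<Longrightarrow> x \<le> a \<Longrightarrow> y \<in> {x..<x + m} \<Longrightarrow> y \<le> b \<Longrightarrow>
    imitation m (a, b) (a - x, b) (a - x, b - y)"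
| "b \<le> a \<Longrightarrow> 0 < x \<Longrightarrow> x \<le> b \<Longrightarrow> y \<in> {x..<x + m} \<Longrightarrow> y \<le> a \<Longrightarrow>
    imitation m (a, b) (a, b - x) (a - y, b - x)"

text \<open>A play is the list of all positions visited so far, the current one first. The entries
  \<open>h ! k\<close> with \<open>k\<close> even were reached by moves of the player who moved last, except that the last
  entry of \<open>h\<close> is the starting position.\<close>

definition imitation_at :: "nat \<Rightarrow> position list \<Rightarrow> nat \<Rightarrow> bool" where
  "imitation_at m h k \<longleftrightarrow>
    k + 2 < length h \<and> imitation m (h ! (k + 2)) (h ! (k + 1)) (h ! k)"

inductive imitation_nim_move :: "nat \<Rightarrow> nat \<Rightarrow> position list \<Rightarrow> position list \<Rightarrow> bool"
  for p m :: nat where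
  "nim_move v w \<Longrightarrow> \<not> (\<forall>j<p. imitation_at m (w # v # h) (2 * j)) \<Longrightarrow>
    imitation_nim_move p m (v # h) (w # v # h)"

definition imitation_nim_P :: "nat \<Rightarrow> nat \<Rightarrow> position \<Rightarrow> bool" where
  "imitation_nim_P p m u \<longleftrightarrow> previous_wins (imitation_nim_move p m) [u]"


inductive wythoff_option :: "nat \<Rightarrow> position \<Rightarrow> position \<Rightarrow> bool" for m :: nat where
  "nim_move u v \<Longrightarrow> wythoff_option m u v"
| "0 < x \<Longrightarrow> x \<le> a \<Longrightarrow> 0 < y \<Longrightarrow> y \<le> b \<Longrightarrow> \<bar>int x - int y\<bar> < int m \<Longrightarrow>
    wythoff_option m (a, b) (a - x, b - y)"

definition legal_block :: "nat \<Rightarrow> position \<Rightarrow> position set \<Rightarrow> bool" where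
  "legal_block p u B \<longleftrightarrow> finite B \<and> card B \<le> p - 1 \<and>
    (\<forall>v\<in>B. int (snd v) - int (fst v) = int (snd u) - int (fst u))"

text \<open>A state of the game with blocking is a position together with the set of positions currently
  blocked by the previous player. A turn consists of a move to a position that is not blocked,
  followed by the mover's announcement for the reply of the opponent.\<close>

inductive wythoff_nim_move ::
  "nat \<Rightarrow> nat \<Rightarrow> position \<times> position set \<Rightarrow> position \<times> position set \<Rightarrow> bool"
  for p m :: nat where
  "wythoff_option m u v \<Longrightarrow> v \<notin> B \<Longrightarrow> legal_block p v C \<Longrightarrow>
    wythoff_nim_move p m (u, B) (v, C)"

definition wythoff_nim_P :: "nat \<Rightarrow> nat \<Rightarrow> position \<Rightarrow> bool" where
  "wythoff_nim_P p m u \<longleftrightarrow>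
    (\<exists>B. legal_block p u B \<and> previous_wins (wythoff_nim_move p m) (u, B))"

end

theory Submission
  imports Defs
begin

text \<open>Both games have the same $P$-positions because both are governed by the pairs
\<open>(A n, B n)\<close> with \<open>A n = mex {A i, B i | i < n}\<close> and \<open>B n = A n + m * (n div p)\<close>. Every height
belongs to exactly one pair, the differences are multiples of \<open>m\<close>, and every occurring difference is
that of exactly \<open>p\<close> pairs, those with indices \<open>k * p, \<dots>, k * p + p - 1\<close>. Thus \<open>n mod p\<close> counts
the pairs that lie below the \<open>n\<close>-th one on its diagonal.

Three facts about pairs serve both games. No Nim move joins two pairs
(\<open>nim_move_from_pair\<close>). A diagonal move of Wythoff Nim, and hence an imitation together with the
move that it imitates, leads from one pair to another only down the same diagonal
(\<open>wythoff_option_between_pairs\<close>). Finally, from a position that is neither a pair nor one Nim move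
away from a pair, all \<open>p\<close> pairs of some diagonal can be reached by such a double move
(\<open>no_nim_move_to_pair\<close>).

In Wythoff Nim, a pair therefore has at most \<open>p - 1\<close> options that are pairs, all on its own
diagonal, and they can be blocked. Any other position has a pair as an option off its diagonal or
\<open>p\<close> of them as options, and no legal announcement blocks them all.

In Imitation Nim, the blocking is done by the players' own imitations. The previous player wins
in two situations. In the first, the current position is a pair, and he has enough imitations left
to walk down all pairs below it on its diagonal: whenever the opponent removes tokens so as to tempt him into an
imitation, he can afford it. In the second, the next player would like to move to a pair, but this would
be an imitation, after which he would have fewer imitations left than there are pairs below;
the previous player would then tempt him down the diagonal until he has used up his imitations. The
strategy keeps the play within these two situations because an imitation removes tokens from the
strictly larger pile and so can never be imitated itself (\<open>imitation_not_imitable\<close>). Whoever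
makes a tempting move thus starts counting his own imitations from zero. A starting position has
no history, so there only the first situation is possible, and it says that the position is a pair.\<close>

section \<open>Positional determinacy\<close>

lemma previous_wins_not_next_wins:
  "previous_wins move s \<Longrightarrow> \<not> next_wins move s"
  "next_wins move s \<Longrightarrow> \<not> previous_wins move s"
proof (induction rule: previous_wins_next_wins.inducts)
  case (previous_winsI s)
  then show ?case by (auto elim: next_wins.cases)
next
  case (next_winsI s t)
  then show ?case by (auto elim: previous_wins.cases)
qed

text \<open>The usual characterisation of the $P$-positions by a set of cold states that no move connects and
that every other state can reach. It is relative to an invariant, because the legal announcements
of Wythoff Nim and the bound on imitations restrict the states that occur in play.\<close>

lemma previous_wins_iff_cold:
  fixes size_of :: "'s \<Rightarrow> nat"
  assumes decreasing: "\<And>s t. move s t \<Longrightarrow> size_of t < size_of s"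
    and invariant: "\<And>s t. reachable s \<Longrightarrow> move s t \<Longrightarrow> reachable t"
    and independent: "\<And>s t. reachable s \<Longrightarrow> cold s \<Longrightarrow> move s t \<Longrightarrow> \<not> cold t"
    and absorbing: "\<And>s. reachable s \<Longrightarrow> \<not> cold s \<Longrightarrow> \<exists>t. move s t \<and> cold t"
    and "reachable s"
  shows "previous_wins move s \<longleftrightarrow> cold s"
proof -
  have "(cold s \<longrightarrow> previous_wins move s) \<and> (\<not> cold s \<longrightarrow> next_wins move s)"
    using \<open>reachable s\<close>
  proof (induction "size_of s" arbitrary: s rule: less_induct)
    case less
    have IH: "cold t \<Longrightarrow> previous_wins move t" "\<not> cold t \<Longrightarrow> next_wins move t"
      if "move s t" for t
      using less.hyps[OF decreasing[OF that] invariant[OF less.prems that]] by auto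
    show ?case
    proof (intro conjI impI)
      assume "cold s"
      then show "previous_wins move s"
        using independent[OF less.prems] IH(2) by (intro previous_winsI) auto
    next
      assume "\<not> cold s"
      then obtain t where "move s t" "cold t" using absorbing[OF less.prems] by auto
      then show "next_wins move s" using IH(1) by (intro next_winsI)
    qed
  qed
  then show ?thesis
    using previous_wins_not_next_wins(1)[of move s] by auto
qed

section \<open>Moves and imitations\<close>

lemma nim_move_swap: "nim_move (prod.swap v) (prod.swap w) \<longleftrightarrow> nim_move v w"
proof -
  have "nim_move (prod.swap v) (prod.swap w)" if "nim_move v w" for v w
    using that by (auto elim!: nim_move.cases intro: nim_move.intros)
  from this[of v w] this[of "prod.swap v" "prod.swap w"] show ?thesis by auto
qed

text \<open>Exchanging the piles reduces statements about both piles to a fixed order of their heights.\<close>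

lemma imitation_swap:
  "imitation m (prod.swap u) (prod.swap v) (prod.swap w) \<longleftrightarrow> imitation m u v w"
proof -
  have "imitation m (prod.swap u) (prod.swap v) (prod.swap w)" if "imitation m u v w" for u v w
    using that by (auto elim!: imitation.cases simp: imitation.intros)
  from this[of u v w] this[of "prod.swap u" "prod.swap v" "prod.swap w"] show ?thesis by auto
qed

lemma imitation_imp_nim_move: "imitation m u v w \<Longrightarrow> nim_move u v"
  by (auto elim!: imitation.cases intro!: nim_move.intros)

lemma imitation_imp_wythoff_option: "imitation m u v w \<Longrightarrow> wythoff_option m u w"
  by (erule imitation.cases) (auto intro!: wythoff_option.intros(2))

text \<open>An imitation takes from the pile that was at least as high before the imitated move, and that
move reduced the other pile. Hence the imitation takes from the strictly larger
pile, while only removals from a smaller or equal pile can be imitated.\<close>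

lemma imitation_not_imitable: "imitation m t u v \<Longrightarrow> \<not> imitation m u v w"
  by (auto elim!: imitation.cases)

text \<open>The number of consecutive imitations with which the player who moved last has ended the play so
far. The recursion skips the moves of the opponent.\<close>

fun imitation_run :: "nat \<Rightarrow> position list \<Rightarrow> nat" where
  "imitation_run m (w # v # u # h) =
    (if imitation m u v w then Suc (imitation_run m (u # h)) else 0)"
| "imitation_run m h = 0"

lemma le_imitation_run_iff:
  "n \<le> imitation_run m h \<longleftrightarrow> (\<forall>j<n. imitation_at m h (2 * j))"
proof (induction m h arbitrary: n rule: imitation_run.induct)
  case (1 m w v u h)
  have shift: "imitation_at m (w # v # u # h) (2 * Suc j) \<longleftrightarrow> imitation_at m (u # h) (2 * j)" for j
    by (simp add: imitation_at_def)
  have first: "imitation_at m (w # v # u # h) 0 \<longleftrightarrow> imitation m u v w"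
    by (simp add: imitation_at_def numeral_2_eq_2)
  show ?case
  proof (cases n)
    case (Suc k)
    have "(\<forall>j<n. imitation_at m (w # v # u # h) (2 * j)) \<longleftrightarrow>
        imitation m u v w \<and> (\<forall>j<k. imitation_at m (u # h) (2 * j))"
      unfolding Suc All_less_Suc2 shift by (simp add: first)
    then show ?thesis using 1 Suc by auto
  qed simp
qed (auto simp: imitation_at_def)

lemma imitation_nim_move_iff:
  "imitation_nim_move p m h h' \<longleftrightarrow>
    (\<exists>v g w. h = v # g \<and> h' = w # v # g \<and> nim_move v w \<and> imitation_run m h' < p)"
  unfolding imitation_nim_move.simps le_imitation_run_iff[symmetric] not_le by blast

lemma imitation_run_before_imitable:
  assumes "imitation m v w z"
  shows "imitation_run m (w # v # h) = 0"
proof (cases h)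
  case (Cons u h')
  then show ?thesis using imitation_not_imitable[of m u v w z] assms by auto
qed simp

section \<open>Wythoff pairs\<close>

lemma mod_less_mod_of_div_le:
  fixes k n p :: nat
  assumes "k < n" "n div p \<le> k div p"
  shows "k mod p < n mod p"
proof -
  have 1: "k div p \<le> n div p" by (rule div_le_mono) (use assms(1) in linarith)
  have "k div p = n div p" using 1 assms(2) by (rule antisym)
  then have "k div p * p = n div p * p" by (rule arg_cong)
  moreover have "k = k div p * p + k mod p" by (rule div_mult_mod_eq[symmetric])
  moreover have "n = n div p * p + n mod p" by (rule div_mult_mod_eq[symmetric])
  ultimately show ?thesis using assms(1) by (metis nat_add_left_cancel_less)
qed

lemma Suc_pred_mod:
  fixes n p :: nat
  assumes "0 < n mod p"
  shows "Suc ((n - 1) mod p) = n mod p"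
proof (cases n)
  case (Suc i)
  then show ?thesis using assms by (simp add: mod_Suc split: if_splits)
qed (use assms in simp)

text \<open>The sequence \<open>A\<close>, with the terms \<open>B i\<close> spelled out, so that the recursion concerns a single
function.\<close>

function lower_height :: "nat \<Rightarrow> nat \<Rightarrow> nat \<Rightarrow> nat" where
  "lower_height p m n = (LEAST c. c \<notin> lower_height p m ` {..<n} \<union>
     (\<lambda>i. lower_height p m i + m * (i div p)) ` {..<n})"
  by auto
termination by (relation "measure (\<lambda>(p, m, n). n)") auto

declare lower_height.simps [simp del]

definition upper_height :: "nat \<Rightarrow> nat \<Rightarrow> nat \<Rightarrow> nat" where
  "upper_height p m n = lower_height p m n + m * (n div p)"

definition wythoff_pair :: "nat \<Rightarrow> nat \<Rightarrow> nat \<Rightarrow> position \<Rightarrow> bool" where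
  "wythoff_pair p m n v \<longleftrightarrow>
    v = (lower_height p m n, upper_height p m n) \<or> v = (upper_height p m n, lower_height p m n)"

context
  fixes p m :: nat
  assumes p: "0 < p" and m: "0 < m"
begin

abbreviation "A \<equiv> lower_height p m"
abbreviation "B \<equiv> upper_height p m"
abbreviation "pair \<equiv> wythoff_pair p m"

lemma lower_height_eq_mex: "A n = (LEAST c. c \<notin> A ` {..<n} \<union> B ` {..<n})"
  by (subst lower_height.simps) (simp add: upper_height_def[abs_def])

lemma lower_height_fresh: "A n \<notin> A ` {..<n} \<union> B ` {..<n}"
proof -
  have "\<exists>c. c \<notin> A ` {..<n} \<union> B ` {..<n}"
    by (rule ex_new_if_finite) auto
  then show ?thesis
    unfolding lower_height_eq_mex[of n] by (rule LeastI_ex)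
qed

lemma below_lower_height: "c < A n \<Longrightarrow> c \<in> A ` {..<n} \<union> B ` {..<n}"
  unfolding lower_height_eq_mex[of n] using not_less_Least by blast

lemma lower_le_upper: "A n \<le> B n"
  by (simp add: upper_height_def)

lemma strict_mono_lower: "strict_mono A"
proof -
  have "A n < A (Suc n)" for n
  proof -
    have "\<not> A (Suc n) < A n"
    proof
      assume "A (Suc n) < A n"
      from below_lower_height[OF this] have "A (Suc n) \<in> A ` {..<Suc n} \<union> B ` {..<Suc n}"
        by (auto simp: less_Suc_eq)
      then show False using lower_height_fresh by blast
    qed
    moreover have "A (Suc n) \<noteq> A n"
      using lower_height_fresh[of "Suc n"] by auto
    ultimately show ?thesis by linarith
  qed
  then show ?thesis by (simp add: strict_mono_Suc_iff)
qed

lemma lower_less_iff [simp]: "A i < A n \<longleftrightarrow> i < n"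
  and lower_eq_iff [simp]: "A i = A n \<longleftrightarrow> i = n"
  using strict_mono_lower by (auto simp: strict_mono_less strict_mono_eq)

lemma strict_mono_upper: "strict_mono B"
  by (rule strict_monoI)
    (auto simp: upper_height_def intro!: add_less_le_mono mult_le_mono2 div_le_mono)

lemma upper_less_iff [simp]: "B i < B n \<longleftrightarrow> i < n"
  and upper_eq_iff [simp]: "B i = B n \<longleftrightarrow> i = n"
  using strict_mono_upper by (auto simp: strict_mono_less strict_mono_eq)

text \<open>The two sequences share a value only where \<open>m * (n div p) = 0\<close>: if \<open>k < n\<close>, the value \<open>B k\<close> is
excluded when \<open>A n\<close> is chosen, and if \<open>n < k\<close>, then \<open>A n < A k \<le> B k\<close>.\<close>

lemma lower_eq_upperD: "A n = B k \<Longrightarrow> n = k"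
proof (rule ccontr)
  assume eq: "A n = B k" and "n \<noteq> k"
  then consider "k < n" | "n < k" by linarith
  then show False
  proof cases
    case 1
    then show False using lower_height_fresh[of n] eq by auto
  next
    case 2
    then show False using lower_le_upper[of k] eq lower_less_iff[of n k] by linarith
  qed
qed

text \<open>Since \<open>A\<close> is strictly increasing, \<open>c\<close> is below \<open>A (Suc c)\<close>, and a mex exceeds only values already taken.\<close>

lemma every_height_occurs: obtains n where "c = A n \<or> c = B n"
proof -
  have "c < A (Suc c)"
    using strict_mono_imp_increasing[OF strict_mono_lower, of "Suc c"] by simp
  from below_lower_height[OF this] show ?thesis using that by blast
qed

lemma pair_unique:
  assumes "pair n (c, d)" "pair k (c, e)"
  shows "n = k" "d = e"
  using assms lower_eq_upperD[of n k] lower_eq_upperD[of k n] by (auto simp: wythoff_pair_def)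

lemma pair_swap: "pair n (c, d) \<longleftrightarrow> pair n (d, c)"
  by (auto simp: wythoff_pair_def)

lemma pair_index_unique: "pair n v \<Longrightarrow> pair k v \<Longrightarrow> n = k"
  using pair_unique by (metis prod.collapse)

lemma nim_move_from_pair: "pair n v \<Longrightarrow> nim_move v w \<Longrightarrow> \<not> pair k w"
proof
  assume "nim_move v w" "pair n v" "pair k w"
  then show False
  proof cases
    case (1 x a b)
    then show ?thesis using pair_unique[of n b a k "a - x"] \<open>pair n v\<close> \<open>pair k w\<close>
      by (simp add: pair_swap)
  next
    case (2 y b a)
    then show ?thesis using pair_unique[of n a b k "b - y"] \<open>pair n v\<close> \<open>pair k w\<close> by simp
  qed
qed

text \<open>The signed difference of a pair is a multiple of \<open>m\<close>, so it is not negative as soon as it exceeds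
\<open>- m\<close>. This fixes which coordinate holds the smaller height.\<close>

lemma pair_above_main_diagonal:
  assumes "pair n (c, d)" "int d - int c > - int m"
  shows "c = A n" "d = B n"
proof -
  have "n div p = 0" if "int m * int (n div p) < int m"
  proof -
    from that have "int m * int (n div p) < int m * 1" by simp
    then show ?thesis unfolding mult_less_cancel_left using m by auto
  qed
  then have "B n = A n" if "c = B n" "d = A n"
    using assms(2) that by (simp add: upper_height_def)
  with assms(1) show "c = A n" "d = B n"
    by (auto simp: wythoff_pair_def)
qed

text \<open>Two multiples of \<open>m\<close> that differ by less than \<open>m\<close> are equal.\<close>

lemma pairs_on_close_diagonals:
  assumes "pair i (c, d)" "\<bar>(int (B n) - int (A n)) - (int d - int c)\<bar> < int m"
  shows "c = A i" "d = B i" "i div p = n div p"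
proof -
  have "int d - int c > - int m"
    using assms(2) lower_le_upper[of n] by linarith
  from pair_above_main_diagonal[OF assms(1) this] show cd: "c = A i" "d = B i" .
  have "\<bar>int m * (int (n div p) - int (i div p))\<bar> < int m"
    using assms(2) by (simp add: cd upper_height_def right_diff_distrib)
  then have "int m * \<bar>int (n div p) - int (i div p)\<bar> < int m * 1"
    by (simp add: abs_mult)
  then show "i div p = n div p"
    unfolding mult_less_cancel_left using m by auto
qed

text \<open>Removing \<open>x\<close> and \<open>y\<close> with \<open>\<bar>x - y\<bar> < m\<close> changes the signed difference by less than \<open>m\<close>, so
between pairs it does not change it at all. In particular the two pairs have the same orientation.\<close>

lemma wythoff_option_between_pairs:
  assumes "pair n v" "pair i z" "wythoff_option m v z"
  shows "i < n" "i div p = n div p"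
    "v = (A n, B n) \<Longrightarrow> z = (A i, B i)" "v = (B n, A n) \<Longrightarrow> z = (B i, A i)"
proof -
  have "\<not> nim_move v z" using nim_move_from_pair assms(1,2) by blast
  with assms(3) obtain a b x y where
    v: "v = (a, b)" and z: "z = (a - x, b - y)" and
    x: "0 < x" "x \<le> a" and y: "0 < y" "y \<le> b" and close: "\<bar>int x - int y\<bar> < int m"
    by (auto elim!: wythoff_option.cases)
  have 1: "i < n \<and> i div p = n div p \<and> z = (A i, B i)" if "v = (A n, B n)"
  proof -
    have ab: "a = A n" "b = B n" using that v by auto
    have "\<bar>(int (B n) - int (A n)) - (int (b - y) - int (a - x))\<bar> < int m"
      using x y close by (simp add: ab[symmetric])
    note pairs_on_close_diagonals[OF assms(2)[unfolded z] this]
    moreover from this(1) have "A i < A n" using ab x by linarith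
    ultimately show ?thesis using z by simp
  qed
  have 2: "i < n \<and> i div p = n div p \<and> z = (B i, A i)" if "v = (B n, A n)"
  proof -
    have ab: "a = B n" "b = A n" using that v by auto
    have "\<bar>(int (B n) - int (A n)) - (int (a - x) - int (b - y))\<bar> < int m"
      using x y close by (simp add: ab[symmetric])
    note pairs_on_close_diagonals[OF assms(2)[unfolded z pair_swap[of i "a - x"]] this]
    moreover from this(1) have "A i < A n" using ab y by linarith
    ultimately show ?thesis using z by simp
  qed
  from 1 2 assms(1) show "i < n" "i div p = n div p" unfolding wythoff_pair_def by blast+
  from 1 show "v = (A n, B n) \<Longrightarrow> z = (A i, B i)" by blast
  from 2 show "v = (B n, A n) \<Longrightarrow> z = (B i, A i)" by blast
qed

lemma wythoff_pair_swap [simp]: "pair n (prod.swap v) \<longleftrightarrow> pair n v"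
  by (cases v) (simp add: pair_swap)

text \<open>The partner of \<open>a\<close> cannot be \<open>b\<close> or less, so \<open>a = A n\<close> and \<open>b < B n\<close>. The difference \<open>b - a\<close>
is then less than \<open>m * (n div p)\<close>, and rounding it down to a multiple \<open>m * k\<close> gives a diagonal
whose \<open>p\<close> pairs all have indices less than \<open>n\<close>. To reach one of them, the second removal has to
exceed the first by the remainder \<open>(b - a) mod m\<close>, which an \<open>m\<close>-imitation permits.\<close>

lemma no_nim_move_to_pair_ordered:
  assumes "a \<le> b" and no_pair: "\<And>n. \<not> pair n (a, b)"
    and no_move: "\<And>w n. nim_move (a, b) w \<Longrightarrow> \<not> pair n w"
  obtains k where "\<And>r. r < p \<Longrightarrow> \<exists>w z. imitation m (a, b) w z \<and> pair (k * p + r) z"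
proof -
  obtain n where n: "a = A n \<or> a = B n" using every_height_occurs .
  have partner: "\<not> c \<le> b" if "pair n (a, c)" for c
  proof
    assume "c \<le> b"
    show False
    proof (cases "c = b")
      case False
      then have "nim_move (a, b) (a, b - (b - c))"
        using \<open>c \<le> b\<close> by (intro nim_move.intros) auto
      with no_move[of "(a, c)" n] \<open>c \<le> b\<close> that show False by simp
    qed (use no_pair that in auto)
  qed
  have "a \<noteq> B n"
    using partner[of "A n"] lower_le_upper[of n] \<open>a \<le> b\<close> by (auto simp: wythoff_pair_def)
  with n have a: "a = A n" by blast
  then have "b < B n" using partner[of "B n"] by (auto simp: wythoff_pair_def)
  define k where "k = (b - a) div m"
  have b: "b = a + m * k + (b - a) mod m" using \<open>a \<le> b\<close> by (simp add: k_def)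
  have "m * k < m * (n div p)"
    using \<open>b < B n\<close> b unfolding upper_height_def a by linarith
  then have "Suc k \<le> n div p" by simp
  then have "Suc k * p \<le> n div p * p" by (rule mult_le_mono1)
  then have "k * p + p \<le> n" using div_times_less_eq_dividend[of n p] by (simp only: mult_Suc)
  have "\<exists>w z. imitation m (a, b) w z \<and> pair (k * p + r) z" if "r < p" for r
  proof -
    let ?j = "k * p + r"
    have "A ?j < A n" using \<open>k * p + p \<le> n\<close> that by simp
    have "?j div p = k" using that by simp
    then have B: "B ?j = A ?j + m * k" by (simp add: upper_height_def)
    define x y where "x = a - A ?j" and "y = b - B ?j"
    have x: "0 < x" "x \<le> a" using \<open>A ?j < A n\<close> by (auto simp: x_def a)
    have y: "y = x + (b - a) mod m" "y \<le> b"
      using \<open>A ?j < A n\<close> b unfolding x_def y_def B a by linarith+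
    have "imitation m (a, b) (a - x, b) (a - x, b - y)"
      using \<open>a \<le> b\<close> x y m by (intro imitation.intros) auto
    moreover have "a - x = A ?j" "b - y = B ?j"
      using \<open>A ?j < A n\<close> b unfolding x_def y_def B a by linarith+
    ultimately show ?thesis by (auto simp: wythoff_pair_def)
  qed
  with that show ?thesis .
qed

lemma no_nim_move_to_pair:
  assumes no_pair: "\<And>n. \<not> pair n v" and no_move: "\<And>w n. nim_move v w \<Longrightarrow> \<not> pair n w"
  obtains k where "\<And>r. r < p \<Longrightarrow> \<exists>w z. imitation m v w z \<and> pair (k * p + r) z"
proof -
  obtain a b where v: "v = (a, b)" by (cases v)
  show ?thesis
  proof (cases "a \<le> b")
    case True
    from no_nim_move_to_pair_ordered[OF True no_pair[unfolded v] no_move[unfolded v]] that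
    show ?thesis unfolding v by blast
  next
    case False
    have "\<not> pair n w" if "nim_move (b, a) w" for w n
      using no_move[of "prod.swap w" n] nim_move_swap[of v "prod.swap w"] that by (simp add: v)
    moreover have "\<not> pair n (b, a)" for n
      using no_pair[of n] by (simp add: v pair_swap)
    ultimately obtain k
      where k: "\<And>r. r < p \<Longrightarrow> \<exists>w z. imitation m (b, a) w z \<and> pair (k * p + r) z"
      using no_nim_move_to_pair_ordered[of b a] False by (metis nat_le_linear)
    have "\<exists>w z. imitation m v w z \<and> pair (k * p + r) z" if "r < p" for r
      using k[OF that] imitation_swap[of m "(b, a)"] wythoff_pair_swap by (metis v swap_simp)
    with that show ?thesis .
  qed
qed

text \<open>The tempting move from a pair with another one below it: the opponent would reach that one by
removing exactly as many tokens from the other pile.\<close>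

lemma imitation_down_the_diagonal:
  assumes "pair n v" "0 < n mod p"
  obtains w z where "imitation m v w z" "pair (n - 1) z"
proof -
  from assms(2) obtain i where n: "n = Suc i" by (cases n) auto
  have "i div p = n div p" using assms(2) by (auto simp: n div_Suc)
  then have B: "B n = A n + m * (n div p)" "B i = A i + m * (n div p)"
    by (simp_all add: upper_height_def)
  have "A i < A n" by (simp add: n)
  have "imitation m (A n, B n) (A n - (A n - A i), B n) (A n - (A n - A i), B n - (A n - A i))"
    using \<open>A i < A n\<close> m by (intro imitation.intros) (auto simp: B)
  moreover have "A n - (A n - A i) = A i" "B n - (A n - A i) = B i"
    using \<open>A i < A n\<close> B by linarith+
  ultimately have imit: "imitation m (A n, B n) (A i, B n) (A i, B i)" by simp
  show ?thesis
  proof (cases "v = (A n, B n)")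
    case True
    with imit that show ?thesis by (auto simp: n wythoff_pair_def)
  next
    case False
    with assms(1) have "v = prod.swap (A n, B n)" by (auto simp: wythoff_pair_def)
    with imit imitation_swap have "imitation m v (prod.swap (A i, B n)) (prod.swap (A i, B i))" by blast
    with that show ?thesis by (auto simp: n wythoff_pair_def)
  qed
qed

text \<open>With \<open>(a - x, b - y)\<close> the \<open>n\<close>-th pair, the smaller pile already has height \<open>A n\<close>, while the larger pile exceeds
\<open>B n\<close>. Reducing the smaller pile instead would give a pair with a smaller lower and a larger upper
height than the \<open>n\<close>-th, whereas both sequences increase.\<close>

lemma imitation_only_nim_move_to_pair_ordered:
  assumes "a \<le> b" "0 < x" "x \<le> a" "y \<in> {x..<x + m}" "y \<le> b"
    and z: "pair n (a - x, b - y)" and w: "nim_move (a - x, b) w" "pair k w"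
  shows "w = (a - x, b - y)"
proof -
  have z_eq: "a - x = A n" "b - y = B n"
    using pair_above_main_diagonal[OF z] assms(1-5) by auto
  from w(1) show ?thesis
  proof cases
    case (1 x')
    then have low: "a - x - x' < A n" and high: "B n < b" using z_eq assms(2-5) by auto
    have "\<not> (A k < A n \<and> B n < B k)" by simp
    with low high 1 w(2) lower_le_upper[of k] lower_le_upper[of n] show ?thesis
      unfolding wythoff_pair_def by auto
  next
    case (2 y')
    with w(2) pair_unique[OF z, of k] show ?thesis by auto
  qed
qed

lemma imitation_only_nim_move_to_pair:
  assumes "imitation m u v z" "pair n z" "nim_move v w" "pair k w"
  shows "w = z"
  using assms(1)
proof cases
  case (1 a b x y)
  then show ?thesis
    using imitation_only_nim_move_to_pair_ordered[of a b x y n w k] assms by simp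
next
  case (2 b a x y)
  then have "prod.swap w = (b - x, a - y)"
    using imitation_only_nim_move_to_pair_ordered[of b a x y n "prod.swap w" k] assms
      nim_move_swap[of v w] by (simp add: pair_swap)
  then show ?thesis using 2 by (cases w) simp
qed

text \<open>Instead of imitating, a player may remove more from the pile that was just reduced; his
opponent may then reach a pair by an imitation of his own. For \<open>m > 1\<close> that pair can be on the
diagonal of the pair not taken, but not on one closer to the main diagonal: already
\<open>b - (a - x)\<close> exceeds \<open>B n - A n\<close>, and the two further removals decrease this difference
by less than \<open>m\<close>.\<close>

lemma imitation_after_imitable_move_ordered:
  assumes "a \<le> b" "0 < x" "x \<le> a" "y \<in> {x..<x + m}" "y \<le> b"
    and z: "pair n (a - x, b - y)"
    and imit: "imitation m (a - x, b) w z'" "pair k z'"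
  shows "k < n" "n div p \<le> k div p"
proof -
  have z_eq: "a - x = A n" "b - y = B n"
    using pair_above_main_diagonal[OF z] assms(1-5) by auto
  have "\<not> b \<le> a - x" using assms(1-3) by linarith
  with imit(1) obtain x' y' where z': "z' = (a - x - x', b - y')"
    and x': "0 < x'" "x' \<le> a - x" and y': "y' \<in> {x'..<x' + m}" "y' \<le> b"
    by cases auto
  have diff: "int (b - y') - int (a - x - x') > int (B n) - int (A n) - int m"
    using x' y' assms(2-5) z_eq by auto
  then have "int (b - y') - int (a - x - x') > - int m"
    using lower_le_upper[of n] by linarith
  from pair_above_main_diagonal[OF imit(2)[unfolded z'] this]
  have k: "a - x - x' = A k" "b - y' = B k" .
  then have "A k < A n" using x' z_eq by linarith
  then show "k < n" by simp
  have "int m * int (n div p) < int m * (int (k div p) + 1)"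
    using diff k by (simp add: upper_height_def distrib_left)
  then show "n div p \<le> k div p"
    unfolding mult_less_cancel_left using m by auto
qed

lemma imitation_after_imitable_move:
  assumes "imitation m u v z" "pair n z" "imitation m v w y" "pair k y"
  shows "k < n" "n div p \<le> k div p"
proof -
  from assms(1) have "k < n \<and> n div p \<le> k div p"
  proof cases
    case (1 a b x y)
    then show ?thesis
      using imitation_after_imitable_move_ordered[of a b x y n w _ k] assms by simp
  next
    case (2 b a x y')
    then show ?thesis
      using imitation_after_imitable_move_ordered[of b a x y' n "prod.swap w" "prod.swap y" k] assms
        imitation_swap[of m v w y] by (simp add: pair_swap)
  qed
  then show "k < n" "n div p \<le> k div p" by auto
qed

section \<open>Blocking Wythoff Nim\<close>

lemma wythoff_option_decreases: "wythoff_option m u v \<Longrightarrow> fst v + snd v < fst u + snd u"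
  by (auto elim!: wythoff_option.cases nim_move.cases)

text \<open>The options that are pairs have the indices from \<open>p * (n div p)\<close> to \<open>n - 1\<close>, and the index
determines the option, because the orientation is that of \<open>v\<close>. There are \<open>n mod p\<close> such indices.\<close>

lemma legal_block_of_pair:
  assumes "pair n v"
  shows "legal_block p v {z. wythoff_option m v z \<and> (\<exists>i. pair i z)}" (is "legal_block p v ?C")
proof -
  let ?I = "{p * (n div p)..<n}"
  have index: "i \<in> ?I" if "pair i z" "wythoff_option m v z" for i z
  proof -
    note facts = wythoff_option_between_pairs(1,2)[OF assms that]
    then have "p * (n div p) \<le> i" using times_div_less_eq_dividend[of p i] by simp
    with facts show ?thesis by simp
  qed
  define f where "f i = (if v = (A n, B n) then (A i, B i) else (B i, A i))" for i
  have "z = f i" if "pair i z" "wythoff_option m v z" for i z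
    using wythoff_option_between_pairs(3,4)[OF assms that] assms
    by (auto simp: f_def wythoff_pair_def)
  with index have sub: "?C \<subseteq> f ` ?I" by blast
  have "card ?C \<le> card ?I"
    using surj_card_le[OF _ sub] by simp
  moreover have "n mod p \<le> p - 1" using mod_less_divisor[OF p, of n] by linarith
  moreover have "card ?I = n mod p" by (simp add: minus_mult_div_eq_mod)
  moreover have diagonal:
    "int (snd (f i)) - int (fst (f i)) = int (snd v) - int (fst v)" if "i \<in> ?I" for i
  proof -
    have "i div p = n div p"
      using that p div_le_mono[of i n p] div_le_mono[of "p * (n div p)" i p] by simp
    then show ?thesis using assms by (auto simp: f_def wythoff_pair_def upper_height_def)
  qed
  then have "\<forall>z\<in>?C. int (snd z) - int (fst z) = int (snd v) - int (fst v)"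
    using sub by blast
  ultimately show ?thesis
    using finite_subset[OF sub] unfolding legal_block_def by simp
qed

text \<open>A Nim move leaves the diagonal, so its target cannot be blocked. If no Nim move reaches a pair,
there are \<open>p\<close> distinct pairs among the options, more than may be blocked.\<close>

lemma no_legal_block_of_non_pair:
  assumes no_pair: "\<And>n. \<not> pair n v" and block: "legal_block p v C"
  shows "\<exists>z i. wythoff_option m v z \<and> pair i z \<and> z \<notin> C"
proof (cases "\<exists>w n. nim_move v w \<and> pair n w")
  case True
  then obtain w n where "nim_move v w" "pair n w" by blast
  moreover from this(1) have "int (snd w) - int (fst w) \<noteq> int (snd v) - int (fst v)"
    by cases auto
  ultimately show ?thesis
    using block unfolding legal_block_def by (blast intro: wythoff_option.intros(1))
next
  case False
  then obtain k where k: "\<And>r. r < p \<Longrightarrow> \<exists>w z. imitation m v w z \<and> pair (k * p + r) z"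
    using no_nim_move_to_pair[OF no_pair] by blast
  then have "\<exists>z. wythoff_option m v z \<and> pair (k * p + r) z" if "r < p" for r
    using imitation_imp_wythoff_option that by blast
  then obtain f where f: "\<And>r. r < p \<Longrightarrow> wythoff_option m v (f r) \<and> pair (k * p + r) (f r)"
    by metis
  have "inj_on f {..<p}"
  proof (rule inj_onI)
    fix r s
    assume "r \<in> {..<p}" "s \<in> {..<p}" "f r = f s"
    then show "r = s" using f[of r] f[of s] pair_index_unique[of "k * p + r" "f r" "k * p + s"] by simp
  qed
  then have "card (f ` {..<p}) = p" by (simp add: card_image)
  then have "\<not> f ` {..<p} \<subseteq> C"
    using block p card_mono[of C "f ` {..<p}"] by (auto simp: legal_block_def)
  then show ?thesis using f by blast
qed

lemma wythoff_nim_P_iff_pair: "wythoff_nim_P p m v \<longleftrightarrow> (\<exists>n. pair n v)"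
proof -
  (* In a cold state the player to move cannot reach a pair. A suitable announcement makes a pair
     cold; no legal announcement does so for another position. *)
  define cold where "cold s \<longleftrightarrow>
    (\<forall>z i. wythoff_option m (fst s) z \<longrightarrow> pair i z \<longrightarrow> z \<in> snd s)" for s :: "position \<times> position set"
  have outcome: "previous_wins (wythoff_nim_move p m) s \<longleftrightarrow> cold s"
    if "legal_block p (fst s) (snd s)" for s
  proof (rule previous_wins_iff_cold[where reachable = "\<lambda>s. legal_block p (fst s) (snd s)"
        and size_of = "\<lambda>s. fst (fst s) + snd (fst s)"])
    fix s t
    assume "wythoff_nim_move p m s t"
    then show "fst (fst t) + snd (fst t) < fst (fst s) + snd (fst s)"
      by cases (simp add: wythoff_option_decreases)
  next
    fix s t
    assume "wythoff_nim_move p m s t"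
    then show "legal_block p (fst t) (snd t)"
      by cases simp
  next
    fix s t
    assume "cold s" "wythoff_nim_move p m s t"
    from this(2,1) show "\<not> cold t"
    proof cases
      case (1 u v D C)
      then have "\<not> pair n v" for n using \<open>cold s\<close> by (simp add: cold_def del: split_paired_All) blast
      then show ?thesis using no_legal_block_of_non_pair[of v C] 1 by (auto simp: cold_def)
    qed
  next
    fix s
    assume "\<not> cold s"
    then obtain z n where z: "wythoff_option m (fst s) z" "pair n z" "z \<notin> snd s"
      by (auto simp: cold_def)
    let ?C = "{y. wythoff_option m z y \<and> (\<exists>i. pair i y)}"
    have "wythoff_nim_move p m (fst s, snd s) (z, ?C)"
      using z legal_block_of_pair by (intro wythoff_nim_move.intros) auto
    moreover have "cold (z, ?C)" by (auto simp: cold_def)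
    ultimately show "\<exists>t. wythoff_nim_move p m s t \<and> cold t"
      by (intro exI[of _ "(z, ?C)"]) simp
  qed (use that in auto)
  show ?thesis
  proof
    assume "wythoff_nim_P p m v"
    then obtain C where "legal_block p v C" "cold (v, C)"
      using outcome[of "(v, _)"] by (auto simp: wythoff_nim_P_def)
    then show "\<exists>n. pair n v"
      using no_legal_block_of_non_pair[of v C] by (auto simp: cold_def)
  next
    assume "\<exists>n. pair n v"
    then obtain n where "pair n v" ..
    from legal_block_of_pair[OF this] show "wythoff_nim_P p m v"
      unfolding wythoff_nim_P_def
      by (intro exI[of _ "{z. wythoff_option m v z \<and> (\<exists>i. pair i z)}"] conjI)
        (auto simp: outcome, auto simp: cold_def)
  qed
qed

section \<open>Imitation Nim\<close>

lemma imitation_nim_P_iff_pair: "imitation_nim_P p m v \<longleftrightarrow> (\<exists>n. pair n v)"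
proof -
  let ?run = "imitation_run m"
  (* The two winning situations of the previous player: his imitations suffice for the pairs below
     the current one, or those of the next player would not suffice after moving to a pair. In the
     second one the hypothetical move is always an imitation: otherwise the run would be 0, and
     n mod p < p. *)
  define settled where "settled h \<longleftrightarrow> (\<exists>n. pair n (hd h) \<and> n mod p + ?run h < p)" for h
  define prevented where
    "prevented h \<longleftrightarrow> (\<exists>z n. pair n z \<and> p \<le> n mod p + ?run (z # h))" for h
  have prevented_imitation: "\<exists>z n. pair n z \<and> imitation m u v z \<and> p \<le> Suc (n mod p + ?run (u # g))"
    if "prevented (v # u # g)" for v u g
  proof -
    from that obtain z n where z: "pair n z" "p \<le> n mod p + ?run (z # v # u # g)"
      by (auto simp: prevented_def)
    moreover have "n mod p < p" using p by simp
    ultimately have "imitation m u v z" by (auto split: if_splits)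
    with z show ?thesis by (intro exI[of _ z] exI[of _ n]) auto
  qed
  have preventedI: "prevented (w # v # g)"
    if "imitation m v w z" "pair n z" "p \<le> Suc (n mod p + ?run (v # g))" for v w z n g
    unfolding prevented_def using that by (intro exI[of _ z] exI[of _ n]) auto
  have "previous_wins (imitation_nim_move p m) [v] \<longleftrightarrow> settled [v] \<or> prevented [v]"
  proof (rule previous_wins_iff_cold[where reachable = "\<lambda>h. h \<noteq> [] \<and> ?run h < p"
        and size_of = "\<lambda>h. fst (hd h) + snd (hd h)"])
    fix g h
    assume "imitation_nim_move p m g h"
    then show "fst (hd h) + snd (hd h) < fst (hd g) + snd (hd g)"
      by (auto simp: imitation_nim_move_iff elim!: nim_move.cases)
  next
    fix g h
    assume "imitation_nim_move p m g h"
    then show "h \<noteq> [] \<and> ?run h < p"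
      by (auto simp: imitation_nim_move_iff)
  next
    fix h h'
    assume cold: "settled h \<or> prevented h" and "imitation_nim_move p m h h'"
    then obtain v g w where h: "h = v # g" "h' = w # v # g" "nim_move v w"
      by (auto simp: imitation_nim_move_iff)
    from cold show "\<not> (settled h' \<or> prevented h')"
    proof
      assume "settled h"
      then obtain n where n: "pair n v" "n mod p + ?run (v # g) < p"
        by (auto simp: settled_def h)
      have "\<not> settled h'"
        using nim_move_from_pair[OF n(1) h(3)] by (simp add: settled_def h)
      moreover have "\<not> prevented h'"
      proof
        assume "prevented h'"
        from prevented_imitation[OF this[unfolded h]] obtain z k
          where z: "pair k z" "imitation m v w z" "p \<le> Suc (k mod p + ?run (v # g))" by blast
        (* One more imitation is used, but the new pair has fewer pairs below it. *)
        have "k < n" "k div p = n div p"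
          using wythoff_option_between_pairs(1,2)[OF n(1) z(1)]
            imitation_imp_wythoff_option[OF z(2)] by auto
        then have "k mod p < n mod p"
          by (intro mod_less_mod_of_div_le) simp_all
        then show False using z(3) n(2) by linarith
      qed
      ultimately show ?thesis by blast
    next
      assume "prevented h"
      have "\<not> p \<le> n mod p" for n using p by (simp add: not_le)
      with \<open>prevented h\<close> have "g \<noteq> []" by (auto simp: prevented_def h)
      then obtain u g' where g: "g = u # g'" by (cases g) auto
      from prevented_imitation[OF \<open>prevented h\<close>[unfolded h g]] obtain z n
        where z: "pair n z" "imitation m u v z" "p \<le> Suc (n mod p + ?run (u # g'))" by blast
      have "\<not> settled h'"
      proof
        assume "settled h'"
        then obtain k where k: "pair k w" "k mod p + ?run (w # v # u # g') < p"
          by (auto simp: settled_def h g)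
        have "w = z"
          by (rule imitation_only_nim_move_to_pair[OF z(2,1) h(3) k(1)])
        moreover from this have "k = n" using pair_index_unique[OF k(1)] z(1) by simp
        ultimately show False using k(2) z(2,3) by simp
      qed
      moreover have "\<not> prevented h'"
      proof
        assume "prevented h'"
        from prevented_imitation[OF this[unfolded h]] obtain y k
          where y: "pair k y" "imitation m v w y" "p \<le> Suc (k mod p + ?run (v # g))" by blast
        (* The last move was imitable, hence not an imitation, so the run of the previous player
           restarts here and the new pair has to be the top one of its diagonal. Lying below the
           n-th pair, it would then be on a diagonal closer to the main one. *)
        have "Suc (k mod p) = p"
          using y(3) mod_less_divisor[OF p, of k] unfolding g imitation_run_before_imitable[OF z(2)]
          by linarith
        moreover have "k mod p < n mod p"
          using imitation_after_imitable_move[OF z(2,1) y(2,1)] by (rule mod_less_mod_of_div_le)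
        ultimately show False using mod_less_divisor[OF p, of n] by linarith
      qed
      ultimately show ?thesis by blast
    qed
  next
    fix h
    assume h: "h \<noteq> [] \<and> ?run h < p" and not_cold: "\<not> (settled h \<or> prevented h)"
    then obtain v g where v: "h = v # g" by (cases h) auto
    have step: "\<exists>t. imitation_nim_move p m h t \<and> (settled t \<or> prevented t)"
      if "imitation m v w z" "pair n z" "p \<le> Suc (n mod p + ?run h)" for w z n
    proof (intro exI[of _ "w # h"] conjI disjI2)
      show "imitation_nim_move p m h (w # h)"
        using that imitation_run_before_imitable[OF that(1), of g] imitation_imp_nim_move[OF that(1)] p
        by (auto simp: imitation_nim_move_iff v)
      show "prevented (w # h)" using preventedI that by (simp add: v)
    qed
    consider n where "pair n v" | w n where "nim_move v w" "pair n w"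
      | "\<And>n. \<not> pair n v" "\<And>w n. nim_move v w \<Longrightarrow> \<not> pair n w" by blast
    then show "\<exists>t. imitation_nim_move p m h t \<and> (settled t \<or> prevented t)"
    proof cases
      case 1
      (* The previous player lacks imitations: tempt him down to the next pair. *)
      then have large: "p \<le> n mod p + ?run h"
        using not_cold by (auto simp: settled_def v not_less)
      with h have "0 < n mod p" by linarith
      from imitation_down_the_diagonal[OF 1 this] obtain w z
        where z: "imitation m v w z" "pair (n - 1) z" .
      have "Suc ((n - 1) mod p) = n mod p"
        using \<open>0 < n mod p\<close> by (rule Suc_pred_mod)
      then show ?thesis using step[OF z] large by simp
    next
      case 2
      (* If this move were forbidden or left too few imitations, the second winning situation
         of the previous player would be at hand. *)
      have "n mod p + ?run (w # h) < p"
      proof (rule ccontr)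
        assume "\<not> ?thesis"
        then have "prevented h"
          unfolding prevented_def not_less using 2(2) by (intro exI[of _ w] exI[of _ n] conjI)
        with not_cold show False by blast
      qed
      with 2(2) have "settled (w # h)"
        unfolding settled_def list.sel by blast
      moreover have "imitation_nim_move p m h (w # h)"
        unfolding imitation_nim_move_iff
        using order_le_less_trans[OF le_add2 \<open>n mod p + ?run (w # h) < p\<close>] 2(1) v by blast
      ultimately show ?thesis by blast
    next
      case 3
      (* Tempt the opponent to the top pair of the diagonal: he spends one imitation to get there
         and would need p - 1 more. *)
      from no_nim_move_to_pair[OF 3] obtain k where
        k: "\<And>r. r < p \<Longrightarrow> \<exists>w z. imitation m v w z \<and> pair (k * p + r) z" by blast
      from k[of "p - 1"] p obtain w z
        where z: "imitation m v w z" "pair (k * p + (p - 1)) z" by auto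
      have "(k * p + (p - 1)) mod p = p - 1"
        unfolding mod_mult_self3 using p by simp
      then show ?thesis using step[OF z] p by simp
    qed
  qed (use p in auto)
  moreover have "settled [v] \<longleftrightarrow> (\<exists>n. pair n v)"
    using p by (simp add: settled_def)
  moreover have "\<not> prevented [v]"
    using p by (auto simp: prevented_def not_le)
  ultimately show ?thesis by (simp add: imitation_nim_P_def)
qed

end

theorem corollary1:
  fixes p m a b :: nat
  assumes "0 < p" and "0 < m"
  shows "imitation_nim_P p m (a, b) \<longleftrightarrow> wythoff_nim_P p m (a, b)"
  by (simp add: imitation_nim_P_iff_pair[OF assms] wythoff_nim_P_iff_pair[OF assms])

end
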